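(* Let $A\in\mathbb{C}^{n\times n}$ be skew-Hermitian, i.e. $A^*=-A$. Then, with respect to the spectral norm, the structured level-2 condition number of the matrix exponential at $A$ (for the structure of skew-Hermitian matrices) satisfies $$\mathrm{cond}_{\mathrm{struc}}^{[2]}(\exp,A)=0.$$
   Context: Let $\mathbb{S}_{\mathcal{M}}=\{Y\in\mathbb{C}^{n\times n}: Y^*=-Y\}$ be the set of skew-Hermitian matrices, let $f=\exp$ be the matrix exponential, and let $\|\cdot\|$ be the spectral norm. For $A\in\mathbb{S}_{\mathcal{M}}$ the structured level-1 condition number is $$\mathrm{cond}_{\mathrm{struc}}^{[1]}(f,A)=\lim_{\epsilon\to 0}\ \sup_{\substack{\|Y-A\|\leq\epsilon\\ Y\in\mathbb{S}_{\mathcal{M}}}}\frac{\|f(Y)-f(A)\|}{\epsilon},$$ and the structured level-2 condition number is $$\mathrm{cond}_{\mathrm{struc}}^{[2]}(f,A)=\lim_{\epsilon\to 0}\ \sup_{\substack{A+Z\in\mathbb{S}_{\mathcal{M}}\\ \|Z\|\leq\epsilon}}\frac{\left|\mathrm{cond}_{\mathrm{struc}}^{[1]}(f,A+Z)-\mathrm{cond}_{\mathrm{struc}}^{[1]}(f,A)\right|}{\epsilon}.$$ *)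

theory Defs
  imports "HOL-Analysis.Analysis"
begin

definition conj_transpose :: "complex^'n^'m \<Rightarrow> complex^'m^'n" where
  "conj_transpose A = map_matrix cnj (transpose A)"

definition skew_hermitian :: "(complex^'n^'n) set" where
  "skew_hermitian = {Y. conj_transpose Y = - Y}"

text \<open>The type of matrices carries the entrywise Euclidean (Frobenius) norm, so the
  spectral norm, i.e. the operator norm for the Euclidean norm on vectors, has to be
  introduced separately.\<close>

definition spectral_norm :: "complex^'n^'m \<Rightarrow> real" where
  "spectral_norm A = onorm ((*v) A)"

primrec matpow :: "complex^'n^'n \<Rightarrow> nat \<Rightarrow> complex^'n^'n" where
  "matpow A 0 = mat 1"
| "matpow A (Suc k) = A ** matpow A k"

text \<open>The library constant \<open>exp\<close> needs a normed algebra, which the type of matrices is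
  not an instance of (its multiplication is entrywise). The series below always
  converges, see \<open>summable_mexp\<close>.\<close>

definition mexp :: "complex^'n^'n \<Rightarrow> complex^'n^'n" where
  "mexp A = (\<Sum>k. (1 / fact k) *\<^sub>R matpow A k)"

text \<open>The suprema are taken in the extended reals, so that they are meaningful without a
  boundedness assumption. The parameter \<open>S\<close> is the set of structured matrices.\<close>

definition struct_cond1_quot ::
  "(complex^'n^'n) set \<Rightarrow> (complex^'n^'n \<Rightarrow> complex^'n^'n) \<Rightarrow> complex^'n^'n \<Rightarrow> real \<Rightarrow> ereal" where
  "struct_cond1_quot S f A \<epsilon> =
     (SUP Y \<in> {Y. spectral_norm (Y - A) \<le> \<epsilon> \<and> Y \<in> S}. ereal (spectral_norm (f Y - f A) / \<epsilon>))"

definition struct_cond1 ::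
  "(complex^'n^'n) set \<Rightarrow> (complex^'n^'n \<Rightarrow> complex^'n^'n) \<Rightarrow> complex^'n^'n \<Rightarrow> ereal" where
  "struct_cond1 S f A = Lim (at_right 0) (struct_cond1_quot S f A)"

definition struct_cond2_quot ::
  "(complex^'n^'n) set \<Rightarrow> (complex^'n^'n \<Rightarrow> complex^'n^'n) \<Rightarrow> complex^'n^'n \<Rightarrow> real \<Rightarrow> ereal" where
  "struct_cond2_quot S f A \<epsilon> =
     (SUP Z \<in> {Z. A + Z \<in> S \<and> spectral_norm Z \<le> \<epsilon>}.
        \<bar>struct_cond1 S f (A + Z) - struct_cond1 S f A\<bar> / ereal \<epsilon>)"

definition struct_cond2 ::
  "(complex^'n^'n) set \<Rightarrow> (complex^'n^'n \<Rightarrow> complex^'n^'n) \<Rightarrow> complex^'n^'n \<Rightarrow> ereal" where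
  "struct_cond2 S f A = Lim (at_right 0) (struct_cond2_quot S f A)"

lemma norm_matpow_entry_le:
  fixes A :: "complex^'n^'n"
  shows "norm (matpow A k $ i $ j) \<le> (real CARD('n) * norm A) ^ k"
proof (induction k arbitrary: i j)
  case 0
  then show ?case by (simp add: mat_def)
next
  case (Suc k)
  have e: "norm (A $ i $ l) \<le> norm A" for l
    by (meson Finite_Cartesian_Product.norm_nth_le order_trans)
  have "norm (matpow A (Suc k) $ i $ j) \<le> (\<Sum>l\<in>UNIV. norm (A $ i $ l * matpow A k $ l $ j))"
    by (simp add: matrix_matrix_mult_def sum_norm_le)
  also have "\<dots> \<le> (\<Sum>l\<in>(UNIV::'n set). norm A * (real CARD('n) * norm A) ^ k)"
    by (intro sum_mono) (simp add: norm_mult mult_mono e Suc.IH)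
  finally show ?case by simp
qed

lemma summable_mexp:
  fixes A :: "complex^'n^'n"
  shows "summable (\<lambda>k. (1 / fact k) *\<^sub>R matpow A k)"
proof (rule summable_comparison_test)
  let ?N = "real CARD('n)" and ?c = "real CARD('n) * norm A"
  have m: "norm (matpow A k) \<le> ?N * (?N * ?c ^ k)" for k
  proof -
    have "norm (matpow A k) \<le> (\<Sum>i\<in>UNIV. norm (matpow A k $ i))"
      by (simp add: norm_vec_def L2_set_le_sum)
    also have "\<dots> \<le> (\<Sum>i\<in>UNIV. \<Sum>j\<in>UNIV. norm (matpow A k $ i $ j))"
      by (intro sum_mono) (simp add: norm_vec_def L2_set_le_sum)
    also have "\<dots> \<le> (\<Sum>i\<in>(UNIV::'n set). \<Sum>j\<in>(UNIV::'n set). ?c ^ k)"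
      by (intro sum_mono norm_matpow_entry_le)
    finally show ?thesis by simp
  qed
  show "\<exists>M. \<forall>k\<ge>M. norm ((1 / fact k) *\<^sub>R matpow A k) \<le> ?N * (?N * (inverse (fact k) * ?c ^ k))"
  proof (intro exI allI impI)
    fix k :: nat
    have "norm ((1 / fact k) *\<^sub>R matpow A k) = inverse (fact k) * norm (matpow A k)"
      by (simp add: divide_inverse)
    also have "\<dots> \<le> inverse (fact k) * (?N * (?N * ?c ^ k))"
      by (intro mult_left_mono m) simp
    finally show "norm ((1 / fact k) *\<^sub>R matpow A k) \<le> ?N * (?N * (inverse (fact k) * ?c ^ k))"
      by (simp add: mult_ac)
  qed
  show "summable (\<lambda>k. ?N * (?N * (inverse (fact k) * ?c ^ k)))"
    by (intro summable_mult summable_exp)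
qed

end

theory Submission
  imports Defs
begin

text \<open>The level-1 condition number equals 1 at every skew-Hermitian matrix, so the level-2
  quotient vanishes identically. By Duhamel's formula and the unitarity of \<open>exp (t A)\<close>, \<open>exp\<close> is
  1-Lipschitz on skew-Hermitian matrices. The perturbation \<open>Y = A + i \<epsilon> I\<close> is extremal to first
  order: \<open>exp Y = exp (i \<epsilon>) exp A\<close> lies at distance \<open>2 \<bar>sin (\<epsilon> / 2)\<bar>\<close> from \<open>exp A\<close>.\<close>

section \<open>Componentwise derivatives and skew-adjointness\<close>

lemma has_vector_derivative_vecI:
  fixes f :: "real \<Rightarrow> 'a::real_normed_vector^'n"
  assumes "\<And>i. ((\<lambda>t. f t $ i) has_vector_derivative f' $ i) (at t)"
  shows "(f has_vector_derivative f') (at t)"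
proof -
  have "((\<lambda>s. (f s - f t - (s - t) *\<^sub>R f') /\<^sub>R norm (s - t)) \<longlongrightarrow> 0) (at t)"
  proof (rule vec_tendstoI)
    fix i
    show "((\<lambda>s. ((f s - f t - (s - t) *\<^sub>R f') /\<^sub>R norm (s - t)) $ i) \<longlongrightarrow> 0 $ i) (at t)"
      using assms[of i] by (simp add: has_vector_derivative_def has_derivative_at_within)
  qed
  then show ?thesis
    by (simp add: has_vector_derivative_def has_derivative_at_within bounded_linear_scaleR_left)
qed

text \<open>The inner product is the real one, the real part of the Hermitian product, so moving
  \<open>A\<close> across conjugates and transposes its entries. Terms in \<open>A\<close> thus
  cancel when two solutions of \<open>w' = A w\<close> are paired.\<close>

lemma inner_skew_hermitian:
  fixes A :: "complex^'n^'n"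
  assumes "A \<in> skew_hermitian"
  shows "(A *v x) \<bullet> y = - (x \<bullet> (A *v y))"
proof -
  have e: "A $ j $ i = - cnj (A $ i $ j)" for i j
  proof -
    have "conj_transpose A $ j $ i = (- A) $ j $ i"
      using assms by (simp add: skew_hermitian_def)
    then show ?thesis
      by (simp add: conj_transpose_def map_matrix_def transpose_def)
  qed
  have "(A *v x) \<bullet> y = (\<Sum>i\<in>UNIV. \<Sum>j\<in>UNIV. (A $ i $ j * x $ j) \<bullet> (y $ i))"
    by (simp add: inner_vec_def matrix_vector_mult_def inner_sum_left)
  also have "\<dots> = (\<Sum>i\<in>UNIV. \<Sum>j\<in>UNIV. - (x $ j \<bullet> (A $ j $ i * y $ i)))"
    by (intro sum.cong refl, subst e) (simp add: inner_complex_def algebra_simps)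
  also have "\<dots> = (\<Sum>j\<in>UNIV. \<Sum>i\<in>UNIV. - (x $ j \<bullet> (A $ j $ i * y $ i)))"
    by (rule sum.swap)
  also have "\<dots> = - (x \<bullet> (A *v y))"
    by (simp add: inner_vec_def matrix_vector_mult_def inner_sum_right sum_negf)
  finally show ?thesis .
qed

section \<open>The differential equation of the exponential flow\<close>

lemma matpow_scaleR: "matpow (t *\<^sub>R A) k = t ^ k *\<^sub>R matpow A k"
proof (induction k)
  case (Suc k)
  then show ?case
    by (simp add: scalar_matrix_assoc[symmetric] matrix_scalar_ac mult.commute)
qed simp

lemma scaleR_matrix_vector_mult: "(r *\<^sub>R A) *v x = r *\<^sub>R (A *v x)"
  for A :: "complex^'n^'m"
  by (simp add: vec_eq_iff matrix_vector_mult_def scaleR_sum_right)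

text \<open>Applying a matrix to \<open>x\<close> is linear on a finite-dimensional space, hence
  bounded, so it passes through the series and yields a power series in \<open>t\<close>.\<close>

lemma mexp_mult_vec_sums:
  fixes A :: "complex^'n^'n"
  shows "(\<lambda>k. (t ^ k / fact k) *\<^sub>R (matpow A k *v x)) sums (mexp (t *\<^sub>R A) *v x)"
proof -
  have "linear (\<lambda>M :: complex^'n^'n. M *v x)"
    by (rule linearI) (simp_all add: matrix_vector_mult_add_rdistrib scaleR_matrix_vector_mult)
  then have "bounded_linear (\<lambda>M :: complex^'n^'n. M *v x)"
    by (simp add: linear_conv_bounded_linear)
  from bounded_linear.sums[OF this summable_sums[OF summable_mexp[of "t *\<^sub>R A"]]]
  show ?thesis
    by (simp add: mexp_def scaleR_matrix_vector_mult matpow_scaleR)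
qed

lemma mexp_0: "mexp 0 = mat 1"
proof -
  have z: "matpow (0 :: complex^'n^'n) (Suc k) = 0" for k
    by (simp add: matrix_matrix_mult_def vec_eq_iff)
  have "(\<Sum>k. (1 / fact k) *\<^sub>R matpow (0 :: complex^'n^'n) k)
      = (\<Sum>k\<in>{0}. (1 / fact k) *\<^sub>R matpow 0 k)"
  proof (rule suminf_finite)
    fix k :: nat
    assume "k \<notin> {0}"
    then show "(1 / fact k) *\<^sub>R matpow (0 :: complex^'n^'n) k = 0"
      using z by (cases k) (auto simp del: matpow.simps(2))
  qed simp
  then show ?thesis by (simp add: mexp_def)
qed

text \<open>Each component is a power series in \<open>t\<close> with complex coefficients, and
  termwise differentiation shifts the powers of \<open>A\<close> by one.\<close>

lemma mexp_has_vector_derivative: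
  fixes A :: "complex^'n^'n"
  shows "((\<lambda>t. mexp (t *\<^sub>R A) *v x) has_vector_derivative
      A *v (mexp (t *\<^sub>R A) *v x)) (at t)"
proof (rule has_vector_derivative_vecI)
  fix i
  define c where "c k = (matpow A k *v x) $ i / fact k" for k
  have s: "(\<lambda>k. c k * complex_of_real t ^ k) sums (mexp (t *\<^sub>R A) *v x) $ i" for t
    using sums_vec_nth[OF mexp_mult_vec_sums[of t A x], of i]
    by (simp add: c_def scaleR_conv_of_real[where 'a=complex] mult_ac)
  \<comment> \<open>Convergence at real points suffices: the real number \<open>norm z + 1\<close>
    exceeds \<open>z\<close> in modulus.\<close>
  have sm: "summable (\<lambda>k. c k * z ^ k)" for z
    by (rule powser_inside[OF sums_summable[OF s[of "norm z + 1"]]]) simp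
  have "diffs c k = (A *v (matpow A k *v x)) $ i / fact k" for k
    by (simp add: diffs_def c_def matrix_vector_mul_assoc divide_simps del: of_nat_Suc)
  then have d: "(\<lambda>k. diffs c k * complex_of_real t ^ k) sums (A *v (mexp (t *\<^sub>R A) *v x)) $ i"
    using sums_vec_nth[OF bounded_linear.sums[OF matrix_vector_mul_bounded_linear
          mexp_mult_vec_sums[of t A x]], of A i]
    by (simp add: linear_cmul[OF matrix_vector_mul_linear]
        scaleR_conv_of_real[where 'a=complex] mult_ac)
  show "((\<lambda>t. (mexp (t *\<^sub>R A) *v x) $ i) has_vector_derivative
      (A *v (mexp (t *\<^sub>R A) *v x)) $ i) (at t)"
    \<comment> \<open>The complex derivative at a real point is restricted to the real line.\<close>
    using has_vector_derivative_real_field[OF termdiffs_strong_converges_everywhere[OF sm], of t UNIV]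
    by (simp add: sums_unique[OF s, symmetric] sums_unique[OF d, symmetric])
qed

section \<open>Isometric flows and the Lipschitz bound\<close>

text \<open>The squared norm has derivative \<open>2 (w \<bullet> A w)\<close>, which vanishes by
  skewness. This serves both for isometry of the flow and for uniqueness: a solution starting at 0
  stays 0.\<close>

lemma skew_hermitian_flow_norm:
  fixes A :: "complex^'n^'n"
  assumes "A \<in> skew_hermitian"
    and w: "\<And>t. (w has_vector_derivative A *v w t) (at t)"
  shows "norm (w t) = norm (w 0)"
proof -
  have "((\<lambda>s. w s \<bullet> w s) has_vector_derivative w s \<bullet> (A *v w s) + (A *v w s) \<bullet> w s) (at s)" for s
    by (rule bounded_bilinear.has_vector_derivative[OF bounded_bilinear_inner w w])
  then have "((\<lambda>s. w s \<bullet> w s) has_field_derivative 0) (at s)" for s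
    by (simp add: has_real_derivative_iff_has_vector_derivative inner_skew_hermitian[OF assms(1)])
  then have "w t \<bullet> w t = w 0 \<bullet> w 0"
    by (metis DERIV_isconst_all)
  then show ?thesis by (simp add: norm_eq_sqrt_inner)
qed

lemma norm_mexp_mult_vec:
  fixes A :: "complex^'n^'n"
  assumes "A \<in> skew_hermitian"
  shows "norm (mexp (t *\<^sub>R A) *v x) = norm x"
  using skew_hermitian_flow_norm[OF assms mexp_has_vector_derivative, of t x]
  by (simp add: mexp_0)

text \<open>The two flows start together at \<open>x\<close> and are driven apart only by
  \<open>Y - A\<close> acting on a vector of norm \<open>norm x\<close>, for unit time.\<close>

lemma norm_mexp_diff_mult_vec_le:
  fixes A Y :: "complex^'n^'n"
  assumes A: "A \<in> skew_hermitian" and Y: "Y \<in> skew_hermitian"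
  shows "norm ((mexp Y - mexp A) *v x) \<le> spectral_norm (Y - A) * norm x"
proof -
  define u where "u t = mexp (t *\<^sub>R Y) *v x - mexp (t *\<^sub>R A) *v x" for t
  define h where "h t = (Y - A) *v (mexp (t *\<^sub>R Y) *v x)" for t
  \<comment> \<open>Pairing \<open>u\<close> with the solution of the adjoint equation that agrees with it at time 1
    replaces the variation of constants integral by the mean value theorem.\<close>
  define v where "v t = mexp ((t - 1) *\<^sub>R A) *v u 1" for t
  have u': "(u has_vector_derivative A *v u t + h t) (at t)" for t
    unfolding u_def h_def
    by (rule has_vector_derivative_eq_rhs[OF has_vector_derivative_diff[OF
            mexp_has_vector_derivative mexp_has_vector_derivative]])
       (simp add: matrix_vector_mult_diff_rdistrib matrix_vector_mult_diff_distrib)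
  have v': "(v has_vector_derivative A *v v t) (at t)" for t
  proof -
    have "((\<lambda>s. s - 1) has_vector_derivative 1) (at t)"
      by (auto intro!: derivative_eq_intros)
    from vector_diff_chain_at[OF this mexp_has_vector_derivative]
    show ?thesis by (simp add: v_def[abs_def] o_def)
  qed
  have h: "norm (h t) \<le> spectral_norm (Y - A) * norm x" for t
    using onorm[OF matrix_vector_mul_bounded_linear, of "Y - A" "mexp (t *\<^sub>R Y) *v x"]
    by (simp add: h_def spectral_norm_def norm_mexp_mult_vec[OF Y])
  have "((\<lambda>s. u s \<bullet> v s) has_vector_derivative u t \<bullet> (A *v v t) + (A *v u t + h t) \<bullet> v t) (at t)" for t
    by (rule bounded_bilinear.has_vector_derivative[OF bounded_bilinear_inner u' v'])
  \<comment> \<open>The terms in \<open>A\<close> cancel by skewness; only the forcing term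
    \<open>h\<close> survives.\<close>
  then have "((\<lambda>s. u s \<bullet> v s) has_field_derivative h t \<bullet> v t) (at t)" for t
    by (simp add: has_real_derivative_iff_has_vector_derivative inner_skew_hermitian[OF A]
        inner_add_left)
  from MVT2[of 0 1 "\<lambda>s. u s \<bullet> v s" "\<lambda>s. h s \<bullet> v s", OF _ this]
  obtain z where z: "u 1 \<bullet> v 1 - u 0 \<bullet> v 0 = h z \<bullet> v z" by auto
  \<comment> \<open>Here \<open>u 0 = 0\<close> and \<open>v 1 = u 1\<close>, both because
    \<open>mexp 0\<close> is the identity.\<close>
  have "norm (u 1) * norm (u 1) = u 1 \<bullet> v 1 - u 0 \<bullet> v 0"
    by (simp add: u_def v_def mexp_0 norm_eq_sqrt_inner)
  also have "\<dots> \<le> norm (h z) * norm (v z)"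
    unfolding z by (rule norm_cauchy_schwarz)
  also have "\<dots> \<le> spectral_norm (Y - A) * norm x * norm (u 1)"
    using h[of z] by (simp add: v_def norm_mexp_mult_vec[OF A] mult_right_mono)
  \<comment> \<open>Cancelling the factor \<open>norm (u 1)\<close> requires it to be positive;
    otherwise nonnegativity of the bound suffices.\<close>
  finally have "norm (u 1) \<le> spectral_norm (Y - A) * norm x \<or> norm (u 1) = 0"
    by (metis mult_right_le_imp_le norm_ge_zero order_le_less)
  moreover have "0 \<le> spectral_norm (Y - A) * norm x"
    by (rule order_trans[OF norm_ge_zero h])
  ultimately show ?thesis
    by (auto simp: u_def matrix_vector_mult_diff_rdistrib)
qed

lemma spectral_norm_mexp_diff_le:
  fixes A Y :: "complex^'n^'n"
  assumes "A \<in> skew_hermitian" "Y \<in> skew_hermitian"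
  shows "spectral_norm (mexp Y - mexp A) \<le> spectral_norm (Y - A)"
  unfolding spectral_norm_def[of "mexp Y - mexp A"]
  by (rule onorm_le) (rule norm_mexp_diff_mult_vec_le[OF assms])

section \<open>Perturbation by an imaginary scalar matrix\<close>

lemma mat_mult_vec: "mat c *v x = c *s x"
  by (simp add: vec_eq_iff matrix_vector_mult_def mat_def if_distrib[where f="\<lambda>z. z * _"] cong: if_cong)

lemma norm_vector_scalar_mult: "norm (c *s x) = norm c * norm x"
  for x :: "complex^'n"
  by (simp add: norm_vec_def norm_mult L2_set_right_distrib)

lemma skew_hermitian_add_mat:
  fixes A :: "complex^'n^'n"
  assumes "A \<in> skew_hermitian"
  shows "A + mat (\<i> * of_real \<epsilon>) \<in> skew_hermitian"
  using assms
  by (auto simp: skew_hermitian_def conj_transpose_def vec_eq_iff map_matrix_def transpose_def mat_def)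

text \<open>Scaling \<open>Y\<close> and \<open>A\<close> by \<open>t\<close>, and the phase
  likewise, makes both sides solutions of \<open>w' = Y w\<close> with initial value
  \<open>x\<close>. Their difference starts at 0 and keeps its norm.\<close>

lemma mexp_add_mat_mult_vec:
  fixes A :: "complex^'n^'n"
  assumes "A \<in> skew_hermitian"
  shows "mexp (A + mat (\<i> * of_real \<epsilon>)) *v x = exp (\<i> * of_real \<epsilon>) *s (mexp A *v x)"
proof -
  define Y where "Y = A + mat (\<i> * of_real \<epsilon>)"
  define e where "e t = exp (\<i> * of_real \<epsilon> * of_real t)" for t
  define w where "w t = mexp (t *\<^sub>R A) *v x" for t
  define d where "d t = e t *s w t - mexp (t *\<^sub>R Y) *v x" for t
  have e': "(e has_vector_derivative \<i> * of_real \<epsilon> * e t) (at t)" for t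
    unfolding e_def
    by (rule has_vector_derivative_real_field) (auto intro!: derivative_eq_intros)
  have "((\<lambda>t. e t *s w t) has_vector_derivative Y *v (e t *s w t)) (at t)" for t
  proof (rule has_vector_derivative_vecI)
    fix i
    have "((\<lambda>t. w t $ i) has_vector_derivative (A *v w t) $ i) (at t)"
      unfolding w_def
      by (rule bounded_linear.has_vector_derivative[OF bounded_linear_vec_nth
            mexp_has_vector_derivative])
    from has_vector_derivative_mult[OF e' this]
    show "((\<lambda>t. (e t *s w t) $ i) has_vector_derivative (Y *v (e t *s w t)) $ i) (at t)"
      by (simp add: Y_def matrix_vector_mult_add_rdistrib mat_mult_vec
          vector_scalar_commute algebra_simps)
  qed
  then have "(d has_vector_derivative Y *v d t) (at t)" for t
    unfolding d_def matrix_vector_mult_diff_distrib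
    by (intro has_vector_derivative_diff mexp_has_vector_derivative)
  from skew_hermitian_flow_norm[OF _ this, of 1] skew_hermitian_add_mat[OF assms]
  have "d 1 = 0"
    by (simp add: Y_def d_def e_def w_def mexp_0)
  then show ?thesis
    by (simp add: d_def e_def w_def Y_def)
qed

lemma spectral_norm_mexp_add_mat_ge:
  fixes A :: "complex^'n^'n"
  assumes "A \<in> skew_hermitian"
  shows "2 * \<bar>sin (\<epsilon> / 2)\<bar> \<le> spectral_norm (mexp (A + mat (\<i> * of_real \<epsilon>)) - mexp A)"
proof -
  \<comment> \<open>Every vector is stretched by the same factor, so an arbitrary coordinate vector
    attains the bound.\<close>
  let ?x = "axis undefined 1 :: complex^'n"
  have "norm ((mexp (A + mat (\<i> * of_real \<epsilon>)) - mexp A) *v ?x)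
      = norm ((exp (\<i> * of_real \<epsilon>) - 1) *s (mexp A *v ?x))"
    by (simp only: matrix_vector_mult_diff_rdistrib mexp_add_mat_mult_vec[OF assms]
        vector_ssub_ldistrib) (simp add: vec_eq_iff algebra_simps)
  also have "\<dots> = 2 * \<bar>sin (\<epsilon> / 2)\<bar> * norm ?x"
    using norm_mexp_mult_vec[OF assms, of 1 ?x]
    by (simp only: norm_vector_scalar_mult dist_exp_i_1 scaleR_one)
  finally show ?thesis
    using onorm[OF matrix_vector_mul_bounded_linear,
        of "mexp (A + mat (\<i> * of_real \<epsilon>)) - mexp A" ?x]
    by (simp add: spectral_norm_def)
qed

section \<open>Values of the condition numbers\<close>

lemma struct_cond1_quot_mexp_bounds:
  fixes B :: "complex^'n^'n"
  assumes B: "B \<in> skew_hermitian" and "\<epsilon> > 0"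
  shows "ereal (2 * \<bar>sin (\<epsilon> / 2)\<bar> / \<epsilon>) \<le> struct_cond1_quot skew_hermitian mexp B \<epsilon>"
    and "struct_cond1_quot skew_hermitian mexp B \<epsilon> \<le> 1"
proof -
  let ?Y = "B + mat (\<i> * of_real \<epsilon>)"
  \<comment> \<open>This makes \<open>?Y\<close> an admissible competitor in the supremum.\<close>
  have "spectral_norm (?Y - B) \<le> \<epsilon>"
    using assms by (simp add: spectral_norm_def mat_mult_vec norm_vector_scalar_mult norm_mult onorm_le)
  then have "ereal (spectral_norm (mexp ?Y - mexp B) / \<epsilon>) \<le> struct_cond1_quot skew_hermitian mexp B \<epsilon>"
    unfolding struct_cond1_quot_def
    by (intro SUP_upper) (auto intro: skew_hermitian_add_mat B)
  then show "ereal (2 * \<bar>sin (\<epsilon> / 2)\<bar> / \<epsilon>) \<le> struct_cond1_quot skew_hermitian mexp B \<epsilon>"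
    by (rule order_trans[rotated])
       (use assms in \<open>simp add: divide_right_mono spectral_norm_mexp_add_mat_ge\<close>)
  show "struct_cond1_quot skew_hermitian mexp B \<epsilon> \<le> 1"
    unfolding struct_cond1_quot_def
  proof (rule SUP_least)
    fix Y assume "Y \<in> {Y. spectral_norm (Y - B) \<le> \<epsilon> \<and> Y \<in> skew_hermitian}"
    then have "spectral_norm (mexp Y - mexp B) \<le> \<epsilon>"
      using spectral_norm_mexp_diff_le[OF B, of Y] by auto
    then show "ereal (spectral_norm (mexp Y - mexp B) / \<epsilon>) \<le> 1"
      using assms by (simp add: one_ereal_def)
  qed
qed

lemma tendsto_struct_cond1_quot_mexp:
  fixes B :: "complex^'n^'n"
  assumes "B \<in> skew_hermitian"
  shows "(struct_cond1_quot skew_hermitian mexp B \<longlongrightarrow> 1) (at_right 0)"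
proof (rule tendsto_sandwich[where h = "\<lambda>_. 1"])
  \<comment> \<open>The limit of the lower bound is read off as a derivative at 0.\<close>
  have "((\<lambda>x. sin (x / 2)) has_field_derivative 1 / 2) (at_right (0::real))"
    by (auto intro!: derivative_eq_intros)
  then have "((\<lambda>\<epsilon>::real. sin (\<epsilon> / 2) / \<epsilon>) \<longlongrightarrow> 1 / 2) (at_right 0)"
    by (simp add: has_field_derivative_iff)
  from tendsto_mult_left[OF tendsto_rabs[OF this], of 2]
  have "((\<lambda>\<epsilon>::real. 2 * \<bar>sin (\<epsilon> / 2) / \<epsilon>\<bar>) \<longlongrightarrow> 1) (at_right 0)"
    by simp
  then have "((\<lambda>\<epsilon>::real. 2 * \<bar>sin (\<epsilon> / 2)\<bar> / \<epsilon>) \<longlongrightarrow> 1) (at_right 0)"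
    by (rule Lim_transform_eventually)
       (auto intro: eventually_mono[OF eventually_at_right_less])
  then show "((\<lambda>\<epsilon>::real. ereal (2 * \<bar>sin (\<epsilon> / 2)\<bar> / \<epsilon>)) \<longlongrightarrow> 1) (at_right 0)"
    by (simp add: one_ereal_def)
qed (auto intro!: eventually_mono[OF eventually_at_right_less] struct_cond1_quot_mexp_bounds assms)

lemma struct_cond1_mexp:
  fixes B :: "complex^'n^'n"
  assumes "B \<in> skew_hermitian"
  shows "struct_cond1 skew_hermitian mexp B = 1"
  unfolding struct_cond1_def
  by (rule tendsto_Lim[OF _ tendsto_struct_cond1_quot_mexp[OF assms]]) simp

lemma struct_cond2_quot_mexp:
  fixes A :: "complex^'n^'n"
  assumes "A \<in> skew_hermitian" "\<epsilon> > 0"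
  shows "struct_cond2_quot skew_hermitian mexp A \<epsilon> = 0"
proof -
  let ?S = "{Z. A + Z \<in> skew_hermitian \<and> spectral_norm Z \<le> \<epsilon>}"
  have "0 \<in> ?S"
    using assms by (simp add: spectral_norm_def onorm_le)
  \<comment> \<open>Over an empty set the supremum would be \<open>-\<infinity>\<close> instead of
    0.\<close>
  then have "?S \<noteq> {}" by blast
  \<comment> \<open>Both values are the finite number 1, so the extended-real difference is truly
    0.\<close>
  moreover have "\<bar>struct_cond1 skew_hermitian mexp (A + Z) - struct_cond1 skew_hermitian mexp A\<bar>
      / ereal \<epsilon> = 0" if "Z \<in> ?S" for Z
    using that assms by (simp add: struct_cond1_mexp)
  ultimately show ?thesis
    unfolding struct_cond2_quot_def by (intro SUP_eq_const)
qed

text \<open>\<open>Lim\<close> is a definite description and carries information only if the limit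
  exists, so convergence at both levels is asserted alongside the value.\<close>

theorem proposition3p2:
  fixes A :: "complex^'n^'n"
  assumes "A \<in> skew_hermitian"
  shows "(\<forall>B :: complex^'n^'n. B \<in> skew_hermitian \<longrightarrow>
            (\<exists>l::real. (struct_cond1_quot skew_hermitian mexp B \<longlongrightarrow> ereal l) (at_right 0)))
       \<and> (\<exists>l::ereal. (struct_cond2_quot skew_hermitian mexp A \<longlongrightarrow> l) (at_right 0))
       \<and> struct_cond2 skew_hermitian mexp A = 0"
proof -
  have "\<forall>\<^sub>F \<epsilon> in at_right 0. struct_cond2_quot skew_hermitian mexp A \<epsilon> = 0"
    by (rule eventually_mono[OF eventually_at_right_less]) (rule struct_cond2_quot_mexp[OF assms])
  then have lim: "(struct_cond2_quot skew_hermitian mexp A \<longlongrightarrow> 0) (at_right 0)"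
    by (rule tendsto_eventually)
  then have "struct_cond2 skew_hermitian mexp A = 0"
    unfolding struct_cond2_def by (intro tendsto_Lim) simp_all
  then show ?thesis
    using lim tendsto_struct_cond1_quot_mexp by (auto simp: one_ereal_def)
qed

end
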